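(* Let $k\geq 1$ be an integer and let $n=2k-1$. Say that an intersecting temperate family on $[n]$ is of maximal size if it has the maximum number of member sets among all intersecting temperate families on $[n]$. If $n\neq 3$, the unique intersecting temperate family on $[n]$ of maximal size is $\binom{[2k-1]}{k}\cup\binom{[2k-1]}{k+1}$. If $n=3$, the intersecting temperate families on $[3]$ of maximal size are exactly $\binom{[3]}{2}\cup\binom{[3]}{3}$ together with three additional families, namely $\{ A \in \mathcal{P}([3]) : i\in A\}$ for each $i\in [3]$.
   Context: $[n]=\{1,\ldots,n\}$, $\mathcal{P}(X)$ denotes the power set of $X$, and $\binom{[n]}{m}$ denotes the set of subsets of $[n]$ of size $m$ (empty if $m>n$). A family on $[n]$ is a subset $\mathcal{F}\subseteq \mathcal{P}([n])$. For a family $\mathcal{F}\subseteq\mathcal{P}([n])$ and a set $A\in\mathcal{P}([n])$, let $\mu_{\mathcal{F}}(A)=|\mathcal{P}(A)\cap\mathcal{F}|$. The family $\mathcal{F}$ is called temperate if $\mu_{\mathcal{F}}(A)\leq 1+|A|$ for all $A\in\mathcal{F}$. A family is intersecting if the intersection of any two (not necessarily distinct) elements of it is non-empty; in particular, an intersecting family does not contain the empty set. *)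

theory Defs
  imports "HOL-Library.Ramsey"
begin

definition mu :: "nat set set \<Rightarrow> nat set \<Rightarrow> nat" where
  "mu F A = card (Pow A \<inter> F)"

definition temperate :: "nat set set \<Rightarrow> bool" where
  "temperate F \<longleftrightarrow> (\<forall>A\<in>F. mu F A \<le> 1 + card A)"

text \<open>The two members need not be distinct, so an intersecting family omits the empty set.\<close>
definition intersecting :: "nat set set \<Rightarrow> bool" where
  "intersecting F \<longleftrightarrow> (\<forall>A\<in>F. \<forall>B\<in>F. A \<inter> B \<noteq> {})"

definition intersecting_temperate_on :: "nat \<Rightarrow> nat set set \<Rightarrow> bool" where
  "intersecting_temperate_on n F \<longleftrightarrow>
     F \<subseteq> Pow {1..n} \<and> intersecting F \<and> temperate F"

text \<open>All families on \<open>{1..n}\<close> are finite, so \<open>card\<close> is the true number of members.\<close>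
definition maximal_size :: "nat \<Rightarrow> nat set set \<Rightarrow> bool" where
  "maximal_size n F \<longleftrightarrow> is_arg_max card (intersecting_temperate_on n) F"

end

theory Submission
  imports Complex_Main Defs
begin

text \<open>
The proof weighs a family \<open>F\<close> on a set \<open>S\<close> by its Lubell sum, in which each member
\<open>A \<subseteq> S\<close> counts \<open>1 / (card S choose card A)\<close>. This is the expected number of members
met by a random maximal chain in \<open>Pow S\<close>. If \<open>F\<close> is temperate and omits the empty set, then
the sum is at most 2 (lemma \<open>lubell_le_2\<close>). Indeed, follow the chain downwards
until it meets a first member \<open>B\<close>; below \<open>B\<close> there are at most \<open>card B\<close> further members, and
each of them is met with probability at most \<open>1 / card B\<close>. Instead of chains, the proof uses
the equivalent induction: as long as \<open>S\<close> is not a member, its Lubell sum is the average of the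
sums over the sets \<open>S - {s}\<close>. Read backwards, the induction shows that a family with sum 2 on
\<open>S\<close> also has sum 2 on each of its maximal members \<open>B\<close>, and then every proper subset \<open>A\<close>
of \<open>B\<close> in \<open>F\<close> satisfies \<open>(card B choose card A) = card B\<close>.

An intersecting family never contains both a set and its complement, so levels \<open>j\<close> and
\<open>n - j\<close> together hold at most \<open>n choose j\<close> members. Let \<open>n = 2 * k - 1\<close>. The heaviest pair
of levels, \<open>k\<close> and \<open>k - 1\<close>, can therefore use up at most 1 of the available Lubell weight 2,
and what is left buys members most cheaply in the next pair of levels, \<open>k + 1\<close> and
\<open>k - 2\<close>. This gives the bound \<open>(n choose k) + (n choose (k + 1))\<close>.

In the case of equality the Lubell sum is 2, \<open>F\<close> lives on the levels \<open>k - 2, \<dots>, k + 1\<close>, and from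
every complementary pair of sets on these levels it contains exactly one. Hence \<open>F\<close> is closed
upwards within these levels: the complement of a superset of \<open>A \<in> F\<close> misses \<open>A\<close>. A member of size
\<open>k - 1\<close> would then lie in a member \<open>B\<close> of size \<open>k + 1\<close>, which is maximal, so that
\<open>(k + 1) choose (k - 1) = k + 1\<close>; this is false for \<open>k \<ge> 3\<close>. A member of size \<open>k - 2\<close> would lie in
one of size \<open>k - 1\<close>. So only the levels \<open>k\<close> and \<open>k + 1\<close> remain. For \<open>k = 2\<close> the bound is 4, and
an intersecting family of four sets on three points is either contained in a star or has no
singletons.
\<close>

section \<open>A Lubell-type inequality for temperate families\<close>

definition lubell :: "nat set set \<Rightarrow> nat set \<Rightarrow> real" where
  "lubell F S = (\<Sum>A\<in>F \<inter> Pow S. 1 / real (card S choose card A))"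

text \<open>
For each \<open>s \<notin> A\<close> the term of \<open>A\<close> is the same, and there are \<open>card S - card A\<close> such \<open>s\<close>, so
this is the absorption identity for binomial coefficients.
\<close>

lemma lubell_term_average:
  assumes "finite S" "A \<subset> S"
  shows "(\<Sum>s\<in>S - A. 1 / real (card (S - {s}) choose card A))
           = real (card S) * (1 / real (card S choose card A))"
proof -
  define n j where "n = card S" and "j = card A"
  have jn: "j < n"
    using assms by (simp add: n_def j_def psubset_card_mono)
  have "(n - j) * (n choose j) = n * ((n - 1) choose j)"
    by (rule binomial_absorb_comp)
  hence abs: "real (n - j) * real (n choose j) = real n * real ((n - 1) choose j)"
    by (metis of_nat_mult)
  have pos: "real (n choose j) > 0" "real ((n - 1) choose j) > 0"
    using jn by simp_all
  have card: "card (S - A) = n - j"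
    using assms finite_subset[of A S] by (auto simp: n_def j_def card_Diff_subset)
  have "(\<Sum>s\<in>S - A. 1 / real (card (S - {s}) choose card A))
          = (\<Sum>s\<in>S - A. 1 / real ((n - 1) choose j))"
    using assms by (intro sum.cong) (auto simp: n_def j_def)
  also have "\<dots> = real (n - j) / real ((n - 1) choose j)"
    by (simp add: card)
  also have "\<dots> = real n * (1 / real (n choose j))"
    using abs pos by (simp add: field_simps)
  finally show ?thesis by (simp add: n_def j_def)
qed

text \<open>
A maximal chain passes through exactly one set \<open>S - {s}\<close>; if \<open>S\<close> is not a member, all the
members on the chain lie inside that set.
\<close>

lemma lubell_average:
  assumes fin: "finite S" and notin: "S \<notin> F"
  shows "real (card S) * lubell F S = (\<Sum>s\<in>S. lubell F (S - {s}))"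
proof -
  let ?P = "F \<inter> Pow S"
  have finP: "finite ?P" using fin by simp
  have "(\<Sum>s\<in>S. lubell F (S - {s}))
      = (\<Sum>s\<in>S. \<Sum>A\<in>{A \<in> ?P. s \<notin> A}. 1 / real (card (S - {s}) choose card A))"
    unfolding lubell_def by (intro sum.cong) auto
  also have "\<dots> = (\<Sum>A\<in>?P. \<Sum>s\<in>{s \<in> S. s \<notin> A}. 1 / real (card (S - {s}) choose card A))"
    by (rule sum.swap_restrict[OF fin finP])
  also have "\<dots> = (\<Sum>A\<in>?P. real (card S) * (1 / real (card S choose card A)))"
  proof (rule sum.cong[OF refl])
    fix A assume "A \<in> ?P"
    hence "A \<subset> S" using notin by auto
    from lubell_term_average[OF fin this]
    show "(\<Sum>s\<in>{s \<in> S. s \<notin> A}. 1 / real (card (S - {s}) choose card A))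
            = real (card S) * (1 / real (card S choose card A))"
      by (simp add: set_diff_eq)
  qed
  also have "\<dots> = real (card S) * lubell F S"
    unfolding lubell_def by (simp add: sum_distrib_left)
  finally show ?thesis by simp
qed

lemma binomial_ge_self:
  assumes "0 < j" "j < n"
  shows "n \<le> n choose j"
proof (cases "2 * j \<le> n")
  case True
  thus ?thesis using binomial_mono[of 1 j n] assms by simp
next
  case False
  hence "n choose (n - 1) \<le> n choose j"
    using assms by (intro binomial_antimono) auto
  thus ?thesis using assms binomial_symmetric[of 1 n] by simp
qed

lemma lubell_member:
  assumes "finite S" "S \<in> F"
  shows "lubell F S = 1 + (\<Sum>A\<in>F \<inter> Pow S - {S}. 1 / real (card S choose card A))"
  using assms unfolding lubell_def by (subst sum.remove[of _ S]) auto

lemma temperate_card_proper: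
  assumes "temperate F" "finite S" "S \<in> F"
  shows "card (F \<inter> Pow S - {S}) \<le> card S"
proof -
  have "card (F \<inter> Pow S) \<le> 1 + card S"
    using assms(1,3) by (simp add: temperate_def mu_def Int_commute)
  thus ?thesis using assms(2,3) by (subst card_Diff_singleton) auto
qed

text \<open>
This is where the empty set has to be excluded: its term would be 1, whereas all other
proper subsets lie on levels with at least \<open>card S\<close> sets.
\<close>

lemma proper_term_le:
  assumes "{} \<notin> F" "finite S" "A \<in> F \<inter> Pow S - {S}"
  shows "1 / real (card S choose card A) \<le> 1 / real (card S)"
proof -
  have "A \<subset> S" "A \<noteq> {}" using assms by auto
  hence "0 < card A" "card A < card S"
    using assms(2) by (auto simp: psubset_card_mono card_gt_0_iff finite_subset)
  thus ?thesis
    using binomial_ge_self[of "card A" "card S"] by (simp add: frac_le)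
qed

text \<open>
If \<open>S\<close> is a member, it contributes 1, and temperateness bounds the number of other terms by
\<open>card S\<close>, each at most \<open>1 / card S\<close>. Otherwise the sum is an average of sums of smaller sets.
\<close>

lemma lubell_le_2:
  assumes "temperate F" "{} \<notin> F" "finite S"
  shows "lubell F S \<le> 2"
  using assms(3)
proof (induction "card S" arbitrary: S rule: less_induct)
  case less
  show ?case
  proof (cases "S \<in> F")
    case True
    hence pos: "card S > 0" using assms(2) less.prems by (auto simp: card_gt_0_iff)
    have "(\<Sum>A\<in>F \<inter> Pow S - {S}. 1 / real (card S choose card A))
            \<le> real (card (F \<inter> Pow S - {S})) * (1 / real (card S))"
      by (intro sum_bounded_above proper_term_le[OF assms(2) less.prems])
    also have "\<dots> \<le> real (card S) * (1 / real (card S))"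
      using temperate_card_proper[OF assms(1) less.prems True] by (intro mult_right_mono) auto
    finally show ?thesis
      using pos by (simp add: lubell_member[OF less.prems True])
  next
    case False
    show ?thesis
    proof (cases "S = {}")
      case True
      thus ?thesis using False by (simp add: lubell_def)
    next
      case ne: False
      hence pos: "card S > 0" using less.prems by (simp add: card_gt_0_iff)
      have "(\<Sum>s\<in>S. lubell F (S - {s})) \<le> real (card S) * 2"
        using less.prems pos by (intro sum_bounded_above less.hyps) auto
      hence "real (card S) * lubell F S \<le> real (card S) * 2"
        by (simp add: lubell_average[OF less.prems False])
      thus ?thesis using pos by simp
    qed
  qed
qed

text \<open>
Equality is inherited along any descending path from \<open>S\<close> to \<open>B\<close> on which no member lies above
\<open>B\<close>, since the averaging step applies to each set on the path. It is used for the maximal members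
\<open>B\<close> of \<open>F\<close>.
\<close>

lemma lubell_eq_2_descend:
  assumes F: "temperate F" "{} \<notin> F" and "finite S" "lubell F S = 2"
    and "B \<subseteq> S" and "\<And>T. T \<in> F \<Longrightarrow> B \<subset> T \<Longrightarrow> \<not> T \<subseteq> S"
  shows "lubell F B = 2"
  using assms(3-6)
proof (induction "card S" arbitrary: S rule: less_induct)
  case less
  show ?case
  proof (cases "B = S")
    case True
    thus ?thesis using less.prems by simp
  next
    case False
    then obtain s where s: "s \<in> S" "s \<notin> B" using less.prems(3) by auto
    have "S \<notin> F" using less.prems(3,4) False by blast
    hence avg: "(\<Sum>s\<in>S. lubell F (S - {s})) = (\<Sum>s\<in>S. 2)"
      using lubell_average[OF less.prems(1), of F] less.prems(2) by simp
    \<comment> \<open>An average of numbers that are at most 2 equals 2 only if each of them does.\<close>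
    have "lubell F (S - {s}) = 2"
    proof (rule ccontr)
      assume "lubell F (S - {s}) \<noteq> 2"
      hence "lubell F (S - {s}) < 2"
        using lubell_le_2[OF F, of "S - {s}"] less.prems(1) by simp
      hence "(\<Sum>s\<in>S. lubell F (S - {s})) < (\<Sum>s\<in>S. 2)"
        using lubell_le_2[OF F] less.prems(1) s(1) by (intro sum_strict_mono_ex1) auto
      thus False using avg by simp
    qed
    thus ?thesis
      using less.prems s by (intro less.hyps[of "S - {s}"] card_Diff1_less) auto
  qed
qed

text \<open>
The proper subsets of \<open>B\<close> in \<open>F\<close> have total weight 1, although there are at most \<open>card B\<close>
of them, each of weight at most \<open>1 / card B\<close>. So each weight is exactly \<open>1 / card B\<close>, which
confines \<open>A\<close> to the levels 1 and \<open>card B - 1\<close>.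
\<close>

lemma lubell_eq_2_binomial_proper_subset:
  assumes F: "temperate F" "{} \<notin> F" and B: "finite B" "B \<in> F" "lubell F B = 2"
    and A: "A \<in> F" "A \<subset> B"
  shows "card B choose card A = card B"
proof (rule ccontr)
  assume neq: "card B choose card A \<noteq> card B"
  let ?P = "F \<inter> Pow B - {B}"
  have pos: "card B > 0" using F(2) B by (auto simp: card_gt_0_iff)
  have AP: "A \<in> ?P" using A by auto
  have "0 < card A" "card A < card B"
    using A B F(2) by (auto simp: psubset_card_mono card_gt_0_iff intro: finite_subset)
  hence "card B < card B choose card A"
    using binomial_ge_self[of "card A" "card B"] neq by linarith
  hence lt: "1 / real (card B choose card A) < 1 / real (card B)"
    using pos by (simp add: frac_less2)
  have "(\<Sum>A\<in>?P. 1 / real (card B choose card A)) < (\<Sum>A\<in>?P. 1 / real (card B))"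
    using AP lt B(1) proper_term_le[OF F(2) B(1)] by (intro sum_strict_mono_ex1) auto
  also have "\<dots> \<le> real (card B) * (1 / real (card B))"
    using temperate_card_proper[OF F(1) B(1,2)] pos by (simp add: divide_simps)
  finally show False
    using pos B(3) by (simp add: lubell_member[OF B(1,2)])
qed

section \<open>Complementary levels of an intersecting family\<close>

lemma intersecting_empty_notin: "intersecting F \<Longrightarrow> {} \<notin> F"
  by (auto simp: intersecting_def)

text \<open>
Sending the members off level \<open>j\<close> to their complements transports both levels \<open>j\<close> and
\<open>card X - j\<close> into level \<open>j\<close>. Two members can collide only if they are complementary, which
an intersecting family forbids.
\<close>

lemma inj_on_complement_level:
  assumes "F \<subseteq> Pow X" "intersecting F"
  shows "inj_on (\<lambda>A. if card A = j then A else X - A) F"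
proof (rule inj_onI)
  fix A B
  assume AB: "A \<in> F" "B \<in> F"
    and eq: "(if card A = j then A else X - A) = (if card B = j then B else X - B)"
  have "A \<inter> B \<noteq> {}" "B \<inter> A \<noteq> {}" "A \<subseteq> X" "B \<subseteq> X"
    using assms AB by (auto simp: intersecting_def)
  thus "A = B" using eq by (auto split: if_splits)
qed

lemma complement_level_image:
  assumes "finite X" "F \<subseteq> Pow X" "j \<le> card X"
  shows "(\<lambda>A. if card A = j then A else X - A) `
            {A \<in> F. card A = j \<or> card A = card X - j} \<subseteq> nsets X j"
  using assms by (auto simp: nsets_def card_Diff_subset finite_subset)

lemma card_nsets:
  assumes "finite X"
  shows "card (nsets X j) = card X choose j"
proof -
  have "nsets X j = {B. B \<subseteq> X \<and> card B = j}"
    using assms finite_subset by (auto simp: nsets_def)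
  thus ?thesis by (simp only: n_subsets[OF assms])
qed

lemma card_complementary_levels_le:
  assumes "finite X" "F \<subseteq> Pow X" "intersecting F" "j \<le> card X"
  shows "card {A \<in> F. card A = j \<or> card A = card X - j} \<le> card X choose j"
  using card_inj_on_le[OF inj_on_subset[OF inj_on_complement_level[OF assms(2,3)]]
      complement_level_image[OF assms(1,2,4)]]
    assms(1) by (simp add: card_nsets finite_imp_finite_nsets)

lemma complementary_levels_full:
  assumes "finite X" "F \<subseteq> Pow X" "intersecting F" "j \<le> card X"
    and full: "card {A \<in> F. card A = j \<or> card A = card X - j} = card X choose j"
    and S: "S \<subseteq> X" "card S = j \<or> card S = card X - j"
  shows "S \<in> F \<or> X - S \<in> F"
proof -
  let ?G = "{A \<in> F. card A = j \<or> card A = card X - j}"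
  let ?f = "\<lambda>A. if card A = j then A else X - A"
  have "inj_on ?f ?G"
    by (rule inj_on_subset[OF inj_on_complement_level[OF assms(2,3)]]) auto
  hence "card (?f ` ?G) = card (nsets X j)"
    using full assms(1) by (simp only: card_image card_nsets)
  hence onto: "?f ` ?G = nsets X j"
    using complement_level_image[OF assms(1,2,4)] assms(1)
    by (intro card_subset_eq) (auto simp: finite_imp_finite_nsets)
  define T where "T = (if card S = j then S else X - S)"
  have "T \<in> nsets X j"
    using S assms(1,4) by (auto simp: T_def nsets_def card_Diff_subset finite_subset)
  hence "T \<in> ?f ` ?G" by (simp only: onto)
  then obtain A where A: "A \<in> F" "T = ?f A" by blast
  hence "A = T \<or> A = X - T" using assms(2) by (auto split: if_splits)
  thus ?thesis using A(1) S(1) by (auto simp: T_def double_diff split: if_splits)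
qed

text \<open>
A superset of a member has a complement that misses this member. When the two levels are full,
the superset itself must therefore belong to \<open>F\<close>.
\<close>

lemma complementary_levels_up_closed:
  assumes "finite X" "F \<subseteq> Pow X" "intersecting F" "j \<le> card X"
    and full: "card {A \<in> F. card A = j \<or> card A = card X - j} = card X choose j"
    and "A \<in> F" "A \<subseteq> S" "S \<subseteq> X" "card S = j \<or> card S = card X - j"
  shows "S \<in> F"
proof -
  have "A \<inter> (X - S) = {}" using assms(7) by blast
  hence "X - S \<notin> F" using assms(3,6) unfolding intersecting_def by blast
  thus ?thesis using complementary_levels_full[OF assms(1-5,8,9)] by simp
qed

section \<open>The upper bound and the case of equality\<close>

lemma binomial_off_middle_less:
  assumes "j < k - 1 \<or> k < j" "j \<le> 2 * k - 1"
    "j \<noteq> k - 2" "j \<noteq> k + 1" "2 \<le> k"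
  shows "(2 * k - 1) choose j < (2 * k - 1) choose (k + 1)"
proof (cases "k < j")
  case True
  thus ?thesis using assms by (intro binomial_strict_antimono) auto
next
  case False
  have "(2 * k - 1) choose (k - 2) = (2 * k - 1) choose (2 * k - 1 - (k - 2))"
    using assms by (intro binomial_symmetric) auto
  also have "2 * k - 1 - (k - 2) = k + 1" using assms by auto
  moreover have "(2 * k - 1) choose j < (2 * k - 1) choose (k - 2)"
    using assms False by (intro binomial_strict_mono) auto
  ultimately show ?thesis by simp
qed

lemma binomial_off_middle_le:
  assumes "j < k - 1 \<or> k < j" "j \<le> 2 * k - 1" "2 \<le> k"
  shows "(2 * k - 1) choose j \<le> (2 * k - 1) choose (k + 1)"
proof (cases "j = k - 2 \<or> j = k + 1")
  case True
  moreover have "(2 * k - 1) choose (k - 2) = (2 * k - 1) choose (2 * k - 1 - (k - 2))"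
    using assms by (intro binomial_symmetric) auto
  moreover have "2 * k - 1 - (k - 2) = k + 1" using assms by auto
  ultimately show ?thesis by auto
next
  case False
  thus ?thesis using binomial_off_middle_less[of j k] assms by auto
qed

text \<open>
A linear programme in two variables. The members on the levels \<open>k\<close> and \<open>k - 1\<close>
cost \<open>1 / c\<close> of the Lubell weight each, all others at least \<open>1 / d\<close>. The budget is 2, and at most
\<open>c\<close> of the cheap members are available. At the optimum both constraints
are tight and the \<open>d\<close> remaining members all have the price \<open>1 / d\<close>, which places them on the
levels \<open>k + 1\<close> and \<open>k - 2\<close>; the last three conclusions record this.
\<close>

lemma card_le_two_levels:
  fixes X :: "nat set"
  assumes k: "2 \<le> k" and X: "finite X" "card X = 2 * k - 1"
    and F: "F \<subseteq> Pow X" "intersecting F" "temperate F"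
  defines "c \<equiv> (2 * k - 1) choose k" and "d \<equiv> (2 * k - 1) choose (k + 1)"
  shows "card F \<le> c + d"
    and "card F = c + d \<Longrightarrow> lubell F X = 2"
    and "card F = c + d \<Longrightarrow> card {A \<in> F. card A = k \<or> card A = card X - k} = c"
    and "card F = c + d \<Longrightarrow> card {A \<in> F. card A = k + 1 \<or> card A = card X - (k + 1)} = d"
proof -
  define M R where "M = {A \<in> F. card A = k \<or> card A = card X - k}" and "R = F - M"
  have finF: "finite F" using F(1) X(1) by (meson finite_Pow_iff finite_subset)
  have fin: "finite M" "finite R" using finF by (simp_all add: M_def R_def)
  have cardF: "card F = card M + card R"
    using finF unfolding R_def
    by (subst card_Diff_subset) (auto simp: M_def card_mono)
  have Mc: "card M \<le> c"
    using card_complementary_levels_le[OF X(1) F(1,2), of k] X(2) k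
    by (simp add: M_def c_def)
  have dpos: "0 < d" using k by (simp add: d_def)
  have dc: "d < c" using k unfolding c_def d_def by (intro binomial_strict_antimono) auto
  have Acard: "card A \<le> 2 * k - 1" if "A \<in> F" for A
    using that F(1) X by (metis PowD card_mono subsetD)
  have symk: "(2 * k - 1) choose (k - 1) = c"
    using k binomial_symmetric[of k "2 * k - 1"] by (simp add: c_def)
  have M_levels: "card A = k \<or> card A = k - 1" if "A \<in> M" for A
    using that X(2) k by (auto simp: M_def)
  have R_levels: "card A < k - 1 \<or> k < card A" if "A \<in> R" for A
    using that X(2) k by (auto simp: M_def R_def)
  have R_le: "1 / real d \<le> 1 / real ((2 * k - 1) choose card A)" if "A \<in> R" for A
  proof -
    have le: "card A \<le> 2 * k - 1" using Acard that by (auto simp: R_def)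
    have "(2 * k - 1) choose card A \<le> d"
      using binomial_off_middle_le R_levels[OF that] le k unfolding d_def by blast
    thus ?thesis using le by (intro frac_le) auto
  qed
  have sub: "F \<inter> Pow X = M \<union> R" using F(1) by (auto simp: M_def R_def)
  have "lubell F X = (\<Sum>A\<in>M. 1 / real ((2 * k - 1) choose card A))
                     + (\<Sum>A\<in>R. 1 / real ((2 * k - 1) choose card A))"
    unfolding lubell_def X(2) sub using fin by (intro sum.union_disjoint) (auto simp: R_def)
  also have "(\<Sum>A\<in>M. 1 / real ((2 * k - 1) choose card A)) = (\<Sum>A\<in>M. 1 / real c)"
  proof (rule sum.cong[OF refl])
    fix A assume "A \<in> M"
    thus "1 / real ((2 * k - 1) choose card A) = 1 / real c"
      using M_levels[of A] symk by (metis c_def)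
  qed
  finally have L: "lubell F X = real (card M) / real c
                     + (\<Sum>A\<in>R. 1 / real ((2 * k - 1) choose card A))"
    by simp
  have RL: "real (card R) / real d \<le> (\<Sum>A\<in>R. 1 / real ((2 * k - 1) choose card A))"
    using sum_mono[of R "\<lambda>_. 1 / real d", OF R_le] by simp
  have L2: "lubell F X \<le> 2"
    using lubell_le_2 F intersecting_empty_notin X(1) by blast
  \<comment> \<open>Giving up a set on the levels \<open>k\<close> and \<open>k - 1\<close> frees weight for only \<open>d / c < 1\<close> other sets.\<close>
  have weak: "real (card R) / real d \<le> 2 - real (card M) / real c"
    using L RL L2 by linarith
  define m where "m = real (card M) / real c"
  have m1: "m \<le> 1" using Mc dc by (simp add: m_def)
  have mc: "real (card M) = m * c" using dc by (simp add: m_def)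
  have Rd: "real (card R) \<le> (2 - m) * d"
    using weak dpos by (simp add: m_def[symmetric] divide_le_eq)
  have gap: "real c + real d - ((2 - m) * d + m * c) = (1 - m) * (real c - real d)"
    by (simp add: algebra_simps)
  have gap0: "(1 - m) * (real c - real d) \<ge> 0" using m1 dc by simp
  have "real (card F) \<le> real c + real d"
    using cardF mc Rd gap gap0 by simp
  thus "card F \<le> c + d" by simp
  have main: "lubell F X = 2 \<and> card M = c \<and>
      card {A \<in> F. card A = k + 1 \<or> card A = card X - (k + 1)} = d"
    if eq: "card F = c + d"
  proof -
    have "(1 - m) * (real c - real d) \<le> 0"
      using eq cardF mc Rd gap by simp
    hence "m = 1" using m1 dc by (simp add: mult_le_0_iff)
    hence Mcard: "card M = c" using mc by simp
    hence Rcard: "card R = d" using cardF eq by simp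
    have LX: "lubell F X = 2"
      using L L2 RL Mcard Rcard dc dpos by simp
    hence sumR: "(\<Sum>A\<in>R. 1 / real ((2 * k - 1) choose card A)) = (\<Sum>A\<in>R. 1 / real d)"
      using L Mcard Rcard dc dpos by simp
    have Rlev: "card A = k - 2 \<or> card A = k + 1" if "A \<in> R" for A
    proof (rule ccontr)
      assume "\<not> ?thesis"
      hence "(2 * k - 1) choose card A < d"
        using binomial_off_middle_less[of "card A" k] R_levels[OF that] Acard[of A] that k
        unfolding d_def R_def by auto
      hence "1 / real d < 1 / real ((2 * k - 1) choose card A)"
        using Acard[of A] that by (intro frac_less2) (auto simp: R_def)
      hence "(\<Sum>A\<in>R. 1 / real d) < (\<Sum>A\<in>R. 1 / real ((2 * k - 1) choose card A))"
        using that fin(2) R_le by (intro sum_strict_mono_ex1) auto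
      thus False using sumR by simp
    qed
    have "{A \<in> F. card A = k + 1 \<or> card A = card X - (k + 1)} = R"
    proof
      show "R \<subseteq> {A \<in> F. card A = k + 1 \<or> card A = card X - (k + 1)}"
        using Rlev X(2) k by (auto simp: R_def)
      show "{A \<in> F. card A = k + 1 \<or> card A = card X - (k + 1)} \<subseteq> R"
        using X(2) k by (auto simp: R_def M_def)
    qed
    thus ?thesis using LX Mcard Rcard by simp
  qed
  show "card F = c + d \<Longrightarrow> lubell F X = 2" using main by blast
  show "card F = c + d \<Longrightarrow> card {A \<in> F. card A = k \<or> card A = card X - k} = c"
    using main by (simp add: M_def)
  show "card F = c + d \<Longrightarrow> card {A \<in> F. card A = k + 1 \<or> card A = card X - (k + 1)} = d"
    using main by simp
qed

lemma card_two_levels: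
  assumes "finite X"
  shows "card (nsets X k \<union> nsets X (k + 1)) = (card X choose k) + (card X choose (k + 1))"
proof -
  have "nsets X k \<inter> nsets X (k + 1) = {}" by (auto simp: nsets_def)
  thus ?thesis
    using assms by (simp add: card_Un_disjoint finite_imp_finite_nsets card_nsets)
qed

text \<open>
The restriction \<open>k \<ge> 3\<close> is essential: for \<open>k = 2\<close> the level \<open>k - 1\<close> consists of
singletons, \<open>(k + 1) choose (k - 1) = k + 1\<close> holds, and the stars attain the bound.
\<close>

lemma two_levels_unique:
  fixes X :: "nat set"
  assumes k: "3 \<le> k" and X: "finite X" "card X = 2 * k - 1"
    and F: "F \<subseteq> Pow X" "intersecting F" "temperate F"
    and eq: "card F = ((2 * k - 1) choose k) + ((2 * k - 1) choose (k + 1))"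
  shows "F = nsets X k \<union> nsets X (k + 1)"
proof -
  have k2: "2 \<le> k" using k by simp
  note bound = card_le_two_levels[OF k2 X F]
  have L: "lubell F X = 2"
    and full: "card {A \<in> F. card A = k \<or> card A = card X - k} = card X choose k"
      "card {A \<in> F. card A = k + 1 \<or> card A = card X - (k + 1)} = card X choose (k + 1)"
    using bound(2-4) eq X(2) by simp_all
  have finF: "finite F" using F(1) X(1) by (meson finite_Pow_iff finite_subset)
  have up: "S \<in> F" if "A \<in> F" "A \<subseteq> S" "S \<subseteq> X" "card S \<in> {k - 2, k - 1, k, k + 1}" for A S
    using complementary_levels_up_closed[OF X(1) F(1,2) _ full(1) that(1-3)]
      complementary_levels_up_closed[OF X(1) F(1,2) _ full(2) that(1-3)] that(4) X(2) k
    by force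
  \<comment> \<open>The two pairs of full levels already account for all members.\<close>
  have levels: "card A \<in> {k - 2, k - 1, k, k + 1}" if "A \<in> F" for A
  proof -
    let ?M = "{A \<in> F. card A = k \<or> card A = card X - k}"
    let ?R = "{A \<in> F. card A = k + 1 \<or> card A = card X - (k + 1)}"
    have "?M \<inter> ?R = {}" using X(2) k by auto
    hence "card (?M \<union> ?R) = card F"
      using finF full eq X(2) by (subst card_Un_disjoint) auto
    hence "?M \<union> ?R = F" using finF by (intro card_subset_eq) auto
    hence "A \<in> ?M \<union> ?R" using that by simp
    thus ?thesis using X(2) k by auto
  qed
  have extend: "\<exists>S. A \<subseteq> S \<and> S \<subseteq> X \<and> card S = m" if "A \<in> F" "card A \<le> m" "m \<le> 2 * k - 1" for A m
    using exists_subset_between[of A m X] that F(1) X by auto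
  \<comment> \<open>By upward closure such a member lies below a member of size \<open>k + 1\<close>, which is maximal in \<open>F\<close>.\<close>
  have no1: "card A \<noteq> k - 1" if A: "A \<in> F" for A
  proof
    assume c: "card A = k - 1"
    then obtain B where B: "A \<subseteq> B" "B \<subseteq> X" "card B = k + 1"
      using extend[OF A, of "k + 1"] k by fastforce
    have BF: "B \<in> F" using up[OF A B(1,2)] B(3) by simp
    have "lubell F B = 2"
    proof (rule lubell_eq_2_descend[OF F(3) _ X(1) L B(2)])
      show "{} \<notin> F" using F(2) by (rule intersecting_empty_notin)
      fix T assume T: "T \<in> F" "B \<subset> T"
      hence "finite T" using F(1) X(1) finite_subset by blast
      hence "k + 1 < card T" using T(2) B(3) psubset_card_mono by metis
      thus "\<not> T \<subseteq> X" using levels[OF T(1)] by auto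
    qed
    moreover have "A \<subset> B" using B c by auto
    ultimately have "card B choose card A = card B"
      using lubell_eq_2_binomial_proper_subset[OF F(3) intersecting_empty_notin[OF F(2)] _ BF _ A] B X(1)
        finite_subset by blast
    hence "(k + 1) choose (k - 1) = k + 1" using B(3) c by simp
    moreover have "(k + 1) choose (k - 1) = (k + 1) choose 2"
      using binomial_symmetric[of "k - 1" "k + 1"] k by simp
    moreover have "(k + 1) choose 2 = (k + 1) choose 1 \<longleftrightarrow> False"
    proof (cases "k = 3")
      case True
      thus ?thesis by (simp add: choose_two)
    next
      case False
      thus ?thesis using binomial_strict_mono[of 1 2 "k + 1"] k by simp
    qed
    ultimately show False by simp
  qed
  have no2: "card A \<noteq> k - 2" if A: "A \<in> F" for A
  proof
    assume c: "card A = k - 2"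
    then obtain S where S: "A \<subseteq> S" "S \<subseteq> X" "card S = k - 1"
      using extend[OF A, of "k - 1"] k by fastforce
    thus False using no1 up[OF A S(1,2)] by simp
  qed
  have "F \<subseteq> nsets X k \<union> nsets X (k + 1)"
  proof
    fix A assume A: "A \<in> F"
    hence "A \<subseteq> X" "finite A" using F(1) X(1) finite_subset by blast+
    moreover have "card A = k \<or> card A = k + 1"
      using levels[OF A] no1[OF A] no2[OF A] by blast
    ultimately show "A \<in> nsets X k \<union> nsets X (k + 1)" by (auto simp: nsets_def)
  qed
  moreover have "card (nsets X k \<union> nsets X (k + 1)) = card F"
    using eq X by (simp only: card_two_levels)
  ultimately show ?thesis
    using X(1) by (intro card_subset_eq) (auto simp: finite_imp_finite_nsets)
qed

section \<open>The extremal families\<close>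

lemma intersecting_two_levels:
  assumes "finite X" "card X < 2 * k"
  shows "intersecting (nsets X k \<union> nsets X (k + 1))"
  unfolding intersecting_def
proof (intro ballI notI)
  fix A B assume A: "A \<in> nsets X k \<union> nsets X (k + 1)" and B: "B \<in> nsets X k \<union> nsets X (k + 1)"
    and "A \<inter> B = {}"
  hence "card (A \<union> B) = card A + card B" by (auto simp: nsets_def card_Un_disjoint)
  moreover have "card (A \<union> B) \<le> card X" using A B assms(1) by (intro card_mono) (auto simp: nsets_def)
  ultimately show False using A B assms(2) by (auto simp: nsets_def)
qed

text \<open>
A member has at most \<open>1 + card A\<close> subsets of the sizes \<open>k\<close> and \<open>k + 1\<close>; for
\<open>card A = k + 1\<close> these are \<open>A\<close> and its facets, with equality.
\<close>

lemma temperate_two_levels: "temperate (nsets X k \<union> nsets X (k + 1))"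
  unfolding temperate_def mu_def
proof
  fix A assume A: "A \<in> nsets X k \<union> nsets X (k + 1)"
  hence fin: "finite A" by (auto simp: nsets_def)
  have "Pow A \<inter> (nsets X k \<union> nsets X (k + 1)) \<subseteq> nsets A k \<union> nsets A (k + 1)"
    by (auto simp: nsets_def)
  hence "card (Pow A \<inter> (nsets X k \<union> nsets X (k + 1))) \<le> card (nsets A k \<union> nsets A (k + 1))"
    using fin by (intro card_mono) (auto simp: finite_imp_finite_nsets)
  also have "\<dots> = (card A choose k) + (card A choose (k + 1))"
    by (rule card_two_levels[OF fin])
  also have "\<dots> \<le> 1 + card A"
    using A by (auto simp: nsets_def binomial_eq_0)
  finally show "card (Pow A \<inter> (nsets X k \<union> nsets X (k + 1))) \<le> 1 + card A" .
qed

lemma maximal_size_iff: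
  assumes "intersecting_temperate_on n G" "card G = N"
    and "\<And>F. intersecting_temperate_on n F \<Longrightarrow> card F \<le> N"
  shows "maximal_size n F \<longleftrightarrow> intersecting_temperate_on n F \<and> card F = N"
proof
  assume "maximal_size n F"
  hence F: "intersecting_temperate_on n F" and "card G \<le> card F"
    using assms(1) by (simp_all add: maximal_size_def is_arg_max_linorder)
  thus "intersecting_temperate_on n F \<and> card F = N"
    using assms(2) assms(3)[OF F] by simp
next
  assume "intersecting_temperate_on n F \<and> card F = N"
  thus "maximal_size n F" using assms(3) by (simp add: maximal_size_def is_arg_max_linorder)
qed

lemma card_star:
  assumes "finite X" "i \<in> X"
  shows "card {A \<in> Pow X. i \<in> A} = 2 ^ (card X - 1)"
proof -
  have "{A \<in> Pow X. i \<in> A} = insert i ` Pow (X - {i})"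
  proof
    show "{A \<in> Pow X. i \<in> A} \<subseteq> insert i ` Pow (X - {i})"
    proof
      fix A assume "A \<in> {A \<in> Pow X. i \<in> A}"
      hence "A = insert i (A - {i})" "A - {i} \<in> Pow (X - {i})" by auto
      thus "A \<in> insert i ` Pow (X - {i})" by (rule image_eqI)
    qed
  qed (use assms in auto)
  moreover have "inj_on (insert i) (Pow (X - {i}))" by (rule inj_onI) blast
  ultimately show ?thesis using assms by (simp add: card_image card_Pow)
qed

text \<open>
A member \<open>A\<close> of a star contains \<open>2 ^ (card A - 1)\<close> members, which exceeds \<open>1 + card A\<close> as soon
as \<open>card A = 4\<close>. So stars on more than three points are not temperate.
\<close>

lemma temperate_star:
  assumes "finite X" "card X \<le> 3"
  shows "temperate {A \<in> Pow X. i \<in> A}"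
  unfolding temperate_def mu_def
proof
  fix A assume A: "A \<in> {A \<in> Pow X. i \<in> A}"
  hence fin: "finite A" using assms by (auto intro: finite_subset)
  have "card A \<le> card X" using A assms by (intro card_mono) auto
  hence le: "card A \<le> 3" using assms by simp
  have "Pow A \<inter> {A \<in> Pow X. i \<in> A} = {B \<in> Pow A. i \<in> B}" using A by auto
  hence "card (Pow A \<inter> {A \<in> Pow X. i \<in> A}) = 2 ^ (card A - 1)"
    using card_star[OF fin] A by simp
  moreover have "card A = 0 \<or> card A = 1 \<or> card A = 2 \<or> card A = 3" using le by auto
  ultimately show "card (Pow A \<inter> {A \<in> Pow X. i \<in> A}) \<le> 1 + card A" by auto
qed

lemma intersecting_star: "intersecting {A \<in> Pow X. i \<in> A}"
  unfolding intersecting_def by blast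

text \<open>
A singleton in \<open>F\<close> forces all members into the star of its point, which has only four sets.
Without singletons only the four sets of size at least 2 are left.
\<close>

lemma intersecting_on_3:
  fixes X :: "nat set"
  assumes X: "finite X" "card X = 3" and F: "F \<subseteq> Pow X" "intersecting F" "card F = 4"
  shows "F = nsets X 2 \<union> nsets X 3 \<or> (\<exists>i\<in>X. F = {A \<in> Pow X. i \<in> A})"
proof (cases "\<exists>i. {i} \<in> F")
  case True
  then obtain i where i: "{i} \<in> F" by blast
  hence iX: "i \<in> X" using F(1) by auto
  have "F \<subseteq> {A \<in> Pow X. i \<in> A}" using i F(1,2) by (fastforce simp: intersecting_def)
  moreover have "card F = card {A \<in> Pow X. i \<in> A}" using card_star[OF X(1) iX] X(2) F(3) by simp
  ultimately have "F = {A \<in> Pow X. i \<in> A}" using X(1) by (intro card_subset_eq) auto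
  thus ?thesis using iX by blast
next
  case False
  have "A \<in> nsets X 2 \<union> nsets X (2 + 1)" if A: "A \<in> F" for A
  proof -
    have "A \<subseteq> X" "finite A" using A F(1) X(1) by (auto intro: finite_subset)
    moreover have "card A \<le> 3" using calculation X card_mono by metis
    moreover have "card A \<noteq> 0" using A calculation(2) intersecting_empty_notin[OF F(2)] by auto
    moreover have "card A \<noteq> 1" using A False by (auto simp: card_1_singleton_iff)
    moreover have "card A = 2 \<or> card A = 3" using calculation(3-5) by linarith
    ultimately show ?thesis by (simp add: nsets_def)
  qed
  moreover have "card F = card (nsets X 2 \<union> nsets X (2 + 1))"
    using F(3) X by (simp only: card_two_levels) (simp add: choose_two)
  ultimately have "F = nsets X 2 \<union> nsets X (2 + 1)"
    using X(1) by (intro card_subset_eq) (auto simp: finite_imp_finite_nsets)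
  thus ?thesis by simp
qed

theorem theorem1p6:
  fixes k n :: nat
  assumes "k \<ge> 1" and "n = 2 * k - 1"
  shows "(n \<noteq> 3 \<longrightarrow>
            {F. maximal_size n F} = {nsets {1..2 * k - 1} k \<union> nsets {1..2 * k - 1} (k + 1)})
       \<and> (n = 3 \<longrightarrow>
            {F. maximal_size n F} =
              {nsets {1..3} 2 \<union> nsets {1..3} 3} \<union> {{A \<in> Pow {1..3}. i \<in> A} | i. i \<in> {1..3}})"
proof -
  define G where "G = nsets {1..n} k \<union> nsets {1..n} (k + 1)"
  define N where "N = (n choose k) + (n choose (k + 1))"
  have G: "intersecting_temperate_on n G" "card G = N"
  proof -
    have "G \<subseteq> Pow {1..n}" by (auto simp: G_def nsets_def)
    thus "intersecting_temperate_on n G"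
      using assms intersecting_two_levels[of "{1..n}" k] temperate_two_levels[of "{1..n}" k]
      by (simp add: intersecting_temperate_on_def G_def)
    show "card G = N" using card_two_levels[of "{1..n}" k] by (simp add: G_def N_def)
  qed
  \<comment> \<open>For \<open>k = 1\<close> the level \<open>k + 1\<close> is empty, and the weighing argument would divide by 0.\<close>
  have k1: "F \<subseteq> {{1}}" if "intersecting_temperate_on n F" "k = 1" for F
  proof
    fix A assume A: "A \<in> F"
    hence "A \<subseteq> {1}" "A \<noteq> {}"
      using that assms(2) intersecting_empty_notin[of F]
      by (auto simp: intersecting_temperate_on_def)
    thus "A \<in> {{1}}" by blast
  qed
  have bound: "card F \<le> N" if F: "intersecting_temperate_on n F" for F
  proof (cases "k = 1")
    case True
    hence "card F \<le> card {{1::nat}}" using k1[OF F] by (intro card_mono) auto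
    thus ?thesis using True assms(2) by (simp add: N_def)
  next
    case False
    thus ?thesis
      using card_le_two_levels(1)[of k "{1..n}" F] F assms
      by (simp add: intersecting_temperate_on_def N_def)
  qed
  have max: "maximal_size n F \<longleftrightarrow> intersecting_temperate_on n F \<and> card F = N" for F
    by (rule maximal_size_iff[OF G bound])
  have unique: "F = G" if F: "intersecting_temperate_on n F" "card F = N" and n: "n \<noteq> 3" for F
  proof (cases "k = 1")
    case True
    hence "N = 1" using assms(2) by (simp add: N_def)
    hence "H = {{1}}" if "intersecting_temperate_on n H" "card H = N" for H
      using card_subset_eq[OF _ k1[OF that(1) True]] that(2) by simp
    thus ?thesis using F G by metis
  next
    case False
    hence "3 \<le> k" using assms n by (cases "k = 2") auto
    thus ?thesis
      using two_levels_unique[of k "{1..n}" F] F assms(2)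
      by (simp add: intersecting_temperate_on_def N_def G_def)
  qed
  have "{F. maximal_size n F} = {G}" if "n \<noteq> 3"
  proof -
    have "maximal_size n F \<longleftrightarrow> F = G" for F
      using max[of F] G unique[of F] that by blast
    thus ?thesis by simp
  qed
  moreover have "{F. maximal_size n F} =
      {nsets {1..3} 2 \<union> nsets {1..3} 3} \<union> {{A \<in> Pow {1..3}. i \<in> A} | i. i \<in> {1..3}}"
    if n: "n = 3"
  proof -
    have k2: "k = 2" using n assms by simp
    have N4: "N = 4" using n k2 by (simp add: N_def choose_two)
    have G3: "G = nsets {1..3} 2 \<union> nsets {1..3} 3" using n k2 by (simp add: G_def)
    have "maximal_size n F \<longleftrightarrow> F = G \<or> (\<exists>i\<in>{1..3}. F = {A \<in> Pow {1..3}. i \<in> A})" for F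
    proof
      assume "maximal_size n F"
      hence "F \<subseteq> Pow {1..3}" "intersecting F" "card F = 4"
        unfolding max N4 unfolding n intersecting_temperate_on_def by blast+
      thus "F = G \<or> (\<exists>i\<in>{1..3}. F = {A \<in> Pow {1..3}. i \<in> A})"
        unfolding G3 by (intro intersecting_on_3) simp_all
    next
      assume "F = G \<or> (\<exists>i\<in>{1..3}. F = {A \<in> Pow {1..3}. i \<in> A})"
      thus "maximal_size n F"
      proof
        assume "F = G"
        thus ?thesis using G by (simp only: max)
      next
        assume "\<exists>i\<in>{1..3}. F = {A \<in> Pow {1..3}. i \<in> A}"
        then obtain i where i: "i \<in> {1..3}" and F: "F = {A \<in> Pow {1..3}. i \<in> A}" ..
        have "F \<subseteq> Pow {1..n}" unfolding F n by (rule Collect_restrict)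
        moreover have "intersecting F" unfolding F by (rule intersecting_star)
        moreover have "temperate F" unfolding F by (rule temperate_star) simp_all
        moreover have "card F = N" unfolding F card_star[OF finite_atLeastAtMost i] N4 by simp
        ultimately show ?thesis by (simp only: max intersecting_temperate_on_def)
      qed
    qed
    thus ?thesis unfolding G3 by blast
  qed
  ultimately show ?thesis using assms(2) by (simp add: G_def)
qed

end
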